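(* Let $C_0$ be a (stationary) exponential covariance function on the real line, $\mathcal{D}=\mathbb{R}$. Let $C_M$ be the covariance function of the corresponding $M$-RA-block with $r_m=(J-1)J^m$ knots for $m=0,\ldots,M-1$, which are placed such that at each resolution $m=0,\ldots,M-1$, a knot is located on each boundary between two subregions at resolution $m+1$ (that is, for every resolution-$m$ region, on each of the $J-1$ boundaries between the adjacent resolution-$(m+1)$ subregions into which it is split). Then the $M$-RA is exact at every knot location; that is, $C_M(s_1,s_2)=C_0(s_1,s_2)$ for any $s_1,s_2\in\mathcal{Q}=\bigcup_{m=0}^M\mathcal{Q}_m$.
   Context: An exponential covariance function on $\mathbb{R}$ is $C_0(s_1,s_2)=\sigma^2\exp(-|s_1-s_2|/\kappa)$ with $\sigma^2,\kappa>0$. Let $M\in\mathbb{N}$ and $J\ge 2$ an integer. Domain partitioning: $\mathcal{D}=\mathbb{R}$ is recursively partitioned into intervals: $\mathcal{D}$ is the disjoint union of $\mathcal{D}_1,\ldots,\mathcal{D}_J$, and each $\mathcal{D}_{j_1,\ldots,j_{m-1}}$ is the disjoint union of $\mathcal{D}_{j_1,\ldots,j_m}$, $j_m=1,\ldots,J$, for $m=1,\ldots,M$. The regions $\mathcal{D}_{j_1,\ldots,j_m}$ are the ($J^m$ many) regions at resolution $m$ (at resolution $0$ the only region is $\mathcal{D}$). Modulating functions: $T_m(s_1,s_2)=1$ if $s_1,s_2$ lie in the same resolution-$m$ region and $T_m(s_1,s_2)=0$ otherwise (so $T_0\equiv1$). Knots: for $m=0,\ldots,M$, $\mathcal{Q}_m\subset\mathcal{D}$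 is a finite set of $r_m$ knots. For finite sets $A,B\subset\mathcal{D}$, $f(A,B)$ denotes the matrix of values of $f$; similarly $f(s,B)$ is a row vector and $f(A,s)$ a column vector. Define recursively $v_0=C_0\cdot T_0$; for $m=0,\ldots,M$, $\mathbf{b}_m(s)'=v_m(s,\mathcal{Q}_m)$ and $\boldsymbol{\Lambda}_m=v_m(\mathcal{Q}_m,\mathcal{Q}_m)$; and for $m=0,\ldots,M-1$, $$v_{m+1}(s_1,s_2)=\big(v_m(s_1,s_2)-\mathbf{b}_m(s_1)'\boldsymbol{\Lambda}_m^{-1}\mathbf{b}_m(s_2)\big)\cdot T_{m+1}(s_1,s_2).$$ The matrices $\boldsymbol{\Lambda}_m$ are assumed invertible. The $M$-RA-block is the process $y_M(s)=\sum_{m=0}^M\mathbf{b}_m(s)'\boldsymbol{\eta}_m$ with independent $\boldsymbol{\eta}_m\sim\mathcal{N}_{r_m}(\mathbf{0},\boldsymbol{\Lambda}_m^{-1})$, whose covariance function is $C_M(s_1,s_2)=\sum_{m=0}^{M} v_m(s_1,\mathcal{Q}_m)v_m(\mathcal{Q}_m,\mathcal{Q}_m)^{-1}v_m(\mathcal{Q}_m,s_2)$. *)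

theory Defs
  imports "HOL-Probability.Probability" "Jordan_Normal_Form.Gauss_Jordan_Elimination"
begin

definition exp_cov :: "real \<Rightarrow> real \<Rightarrow> real \<Rightarrow> real \<Rightarrow> real" where
  "exp_cov sigma2 kappa s1 s2 = sigma2 * exp (- \<bar>s1 - s2\<bar> / kappa)"


subsection \<open>Recursive partitioning\<close>

text \<open>The region with subscripts \<open>j\<^sub>1, \<dots>, j\<^sub>m\<close> is \<open>D [j\<^sub>1, \<dots>, j\<^sub>m]\<close>; the values of \<open>D\<close> outside
  the index sets below are irrelevant.\<close>

definition region_index :: "nat \<Rightarrow> nat \<Rightarrow> nat list set" where
  "region_index J m = {js. length js = m \<and> set js \<subseteq> {1..J}}"

definition recursive_interval_partition :: "nat \<Rightarrow> nat \<Rightarrow> (nat list \<Rightarrow> real set) \<Rightarrow> bool" where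
  "recursive_interval_partition M J D \<longleftrightarrow>
     D [] = UNIV \<and>
     (\<forall>m\<le>M. \<forall>js\<in>region_index J m. is_interval (D js) \<and> D js \<noteq> {}) \<and>
     (\<forall>m<M. \<forall>js\<in>region_index J m.
        D js = (\<Union>j\<in>{1..J}. D (js @ [j])) \<and>
        disjoint_family_on (\<lambda>j. D (js @ [j])) {1..J})"

definition modulating :: "nat \<Rightarrow> (nat list \<Rightarrow> real set) \<Rightarrow> nat \<Rightarrow> real \<Rightarrow> real \<Rightarrow> real" where
  "modulating J D m s1 s2 = (if \<exists>js\<in>region_index J m. s1 \<in> D js \<and> s2 \<in> D js then 1 else 0)"

text \<open>The subregions carry no left-to-right ordering. Two disjoint nonempty intervals have a common
  frontier point exactly when they are adjacent at that point, so no separate adjacency condition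
  is needed.\<close>

definition knots_on_boundaries ::
  "nat \<Rightarrow> nat \<Rightarrow> (nat list \<Rightarrow> real set) \<Rightarrow> (nat \<Rightarrow> real set) \<Rightarrow> bool" where
  "knots_on_boundaries M J D Q \<longleftrightarrow>
     (\<forall>m<M. \<forall>js\<in>region_index J m. \<forall>i\<in>{1..J}. \<forall>j\<in>{1..J}. i \<noteq> j \<longrightarrow>
        frontier (D (js @ [i])) \<inter> frontier (D (js @ [j])) \<subseteq> Q m)"


subsection \<open>The multi-resolution approximation\<close>

text \<open>Finite sets of reals are enumerated increasingly; the quantities below in which the
  enumeration is summed out do not depend on this choice.\<close>

definition eval_mat :: "(real \<Rightarrow> real \<Rightarrow> real) \<Rightarrow> real set \<Rightarrow> real set \<Rightarrow> real mat" where
  "eval_mat f A B = Matrix.mat (card A) (card B)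
     (\<lambda>(i, j). f (sorted_list_of_set A ! i) (sorted_list_of_set B ! j))"

definition eval_row :: "(real \<Rightarrow> real \<Rightarrow> real) \<Rightarrow> real \<Rightarrow> real set \<Rightarrow> real Matrix.vec" where
  "eval_row f s B = Matrix.vec (card B) (\<lambda>j. f s (sorted_list_of_set B ! j))"

definition eval_col :: "(real \<Rightarrow> real \<Rightarrow> real) \<Rightarrow> real set \<Rightarrow> real \<Rightarrow> real Matrix.vec" where
  "eval_col f A s = Matrix.vec (card A) (\<lambda>i. f (sorted_list_of_set A ! i) s)"

text \<open>Meaningful for invertible matrices only.\<close>

abbreviation mat_inv :: "real mat \<Rightarrow> real mat" where
  "mat_inv A \<equiv> the (mat_inverse A)"

primrec mra_v :: "nat \<Rightarrow> (nat list \<Rightarrow> real set) \<Rightarrow> (nat \<Rightarrow> real set) \<Rightarrow>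
    (real \<Rightarrow> real \<Rightarrow> real) \<Rightarrow> nat \<Rightarrow> real \<Rightarrow> real \<Rightarrow> real" where
  "mra_v J D Q C 0 = (\<lambda>s1 s2. C s1 s2 * modulating J D 0 s1 s2)"
| "mra_v J D Q C (Suc m) = (\<lambda>s1 s2.
     (mra_v J D Q C m s1 s2 -
        scalar_prod (eval_row (mra_v J D Q C m) s1 (Q m))
          (mat_inv (eval_mat (mra_v J D Q C m) (Q m) (Q m)) *\<^sub>v
             eval_row (mra_v J D Q C m) s2 (Q m)))
     * modulating J D (Suc m) s1 s2)"

definition mra_b :: "nat \<Rightarrow> (nat list \<Rightarrow> real set) \<Rightarrow> (nat \<Rightarrow> real set) \<Rightarrow>
    (real \<Rightarrow> real \<Rightarrow> real) \<Rightarrow> nat \<Rightarrow> real \<Rightarrow> real Matrix.vec" where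
  "mra_b J D Q C m s = eval_row (mra_v J D Q C m) s (Q m)"

definition mra_Lambda :: "nat \<Rightarrow> (nat list \<Rightarrow> real set) \<Rightarrow> (nat \<Rightarrow> real set) \<Rightarrow>
    (real \<Rightarrow> real \<Rightarrow> real) \<Rightarrow> nat \<Rightarrow> real mat" where
  "mra_Lambda J D Q C m = eval_mat (mra_v J D Q C m) (Q m) (Q m)"

definition mra_cov :: "nat \<Rightarrow> nat \<Rightarrow> (nat list \<Rightarrow> real set) \<Rightarrow> (nat \<Rightarrow> real set) \<Rightarrow>
    (real \<Rightarrow> real \<Rightarrow> real) \<Rightarrow> real \<Rightarrow> real \<Rightarrow> real" where
  "mra_cov M J D Q C s1 s2 =
     (\<Sum>m\<le>M. scalar_prod (eval_row (mra_v J D Q C m) s1 (Q m))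
        (mat_inv (mra_Lambda J D Q C m) *\<^sub>v eval_col (mra_v J D Q C m) (Q m) s2))"


subsection \<open>The process\<close>

definition covariance :: "'w measure \<Rightarrow> ('w \<Rightarrow> real) \<Rightarrow> ('w \<Rightarrow> real) \<Rightarrow> real" where
  "covariance P X Y =
     (\<integral>\<omega>. (X \<omega> - (\<integral>\<omega>'. X \<omega>' \<partial>P)) * (Y \<omega> - (\<integral>\<omega>'. Y \<omega>' \<partial>P)) \<partial>P)"

text \<open>The law \<open>N\<^sub>n(0, S)\<close> for symmetric positive definite \<open>S\<close>: every nontrivial linear combination
  \<open>a' X\<close> is a centered normal variable with variance \<open>a' S a\<close>.\<close>

definition centered_multivariate_normal ::
  "'w measure \<Rightarrow> nat \<Rightarrow> real mat \<Rightarrow> ('w \<Rightarrow> real Matrix.vec) \<Rightarrow> bool" where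
  "centered_multivariate_normal P n S X \<longleftrightarrow>
     S \<in> carrier_mat n n \<and> transpose_mat S = S \<and>
     (\<forall>\<omega>\<in>space P. X \<omega> \<in> carrier_vec n) \<and>
     (\<forall>a\<in>carrier_vec n. a \<noteq> 0\<^sub>v n \<longrightarrow>
        scalar_prod a (S *\<^sub>v a) > 0 \<and>
        distributed P lborel (\<lambda>\<omega>. scalar_prod a (X \<omega>))
          (normal_density 0 (sqrt (scalar_prod a (S *\<^sub>v a)))))"

definition mra_block_process :: "'w measure \<Rightarrow> nat \<Rightarrow> nat \<Rightarrow> (nat list \<Rightarrow> real set) \<Rightarrow>
    (nat \<Rightarrow> real set) \<Rightarrow> (real \<Rightarrow> real \<Rightarrow> real) \<Rightarrow> (real \<Rightarrow> 'w \<Rightarrow> real) \<Rightarrow> bool" where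
  "mra_block_process P M J D Q C y \<longleftrightarrow>
     prob_space P \<and>
     (\<exists>\<eta>. (\<forall>m\<le>M. centered_multivariate_normal P (card (Q m))
                   (mat_inv (mra_Lambda J D Q C m)) (\<eta> m)) \<and>
          prob_space.indep_vars P (\<lambda>m. Pi\<^sub>M {..<card (Q m)} (\<lambda>_. borel))
            (\<lambda>m \<omega>. \<lambda>i\<in>{..<card (Q m)}. vec_index (\<eta> m \<omega>) i) {..M} \<and>
          y = (\<lambda>s \<omega>. \<Sum>m\<le>M. scalar_prod (mra_b J D Q C m s) (\<eta> m \<omega>)))"

end

theory Submission
  imports Defs
begin

text \<open>The exponential covariance is the kernel of a Gaussian Markov process, and the
  Markov property together with the Cauchy--Schwarz inequality survives conditioning on one more
  knot. Conditioning on a finite knot set by means of the inverse matrix is the same as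
  conditioning on its knots one at a time. By the Markov property, the residual kernel vanishes
  at two points separated by a knot already used. Points in different regions of
  resolution \<open>m + 1\<close> are separated by such a knot, so the modulating functions never
  change the residual. Hence the sum defining \<open>C\<^sub>M\<close> telescopes to \<open>C\<^sub>0\<close> minus the residual after all
  knots, which vanishes at the knots.\<close>

section \<open>Markov kernels and the exponential covariance\<close>

text \<open>The last clause is needed because the factorization through \<open>x\<close> says nothing when the
  variance at \<open>x\<close> vanishes, as it does at every knot conditioned on.\<close>

definition markov_kernel :: "('a::linorder \<Rightarrow> 'a \<Rightarrow> real) \<Rightarrow> bool" where
  "markov_kernel v \<longleftrightarrow>
     (\<forall>s t. v s t = v t s) \<and>
     (\<forall>s. 0 \<le> v s s) \<and>
     (\<forall>s t. (v s t)\<^sup>2 \<le> v s s * v t t) \<and>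
     (\<forall>s t. \<forall>x\<in>{min s t..max s t}. v s t * v x x = v s x * v x t) \<and>
     (\<forall>s t. \<forall>x\<in>{min s t..max s t}. v x x = 0 \<longrightarrow> v s t = 0)"

lemma markov_kernelI:
  assumes "\<And>s t. v s t = v t s" and "\<And>s. 0 \<le> v s s" and "\<And>s t. (v s t)\<^sup>2 \<le> v s s * v t t"
    and "\<And>s x t. x \<in> {min s t..max s t} \<Longrightarrow> v s t * v x x = v s x * v x t"
    and "\<And>s x t. x \<in> {min s t..max s t} \<Longrightarrow> v x x = 0 \<Longrightarrow> v s t = 0"
  shows "markov_kernel v"
  unfolding markov_kernel_def using assms by blast

lemma
  assumes "markov_kernel v"
  shows markov_kernel_sym: "v s t = v t s"
    and markov_kernel_nonneg: "0 \<le> v s s"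
    and markov_kernel_cs: "(v s t)\<^sup>2 \<le> v s s * v t t"
    and markov_kernel_between: "x \<in> {min s t..max s t} \<Longrightarrow> v s t * v x x = v s x * v x t"
    and markov_kernel_zero: "x \<in> {min s t..max s t} \<Longrightarrow> v x x = 0 \<Longrightarrow> v s t = 0"
  using assms unfolding markov_kernel_def by blast+

text \<open>Distances add up along \<open>s\<close>, \<open>x\<close>, \<open>t\<close> when
  \<open>x\<close> lies between, and the exponential turns the sum into a product. The last clause
  of \<open>markov_kernel\<close> holds vacuously because every variance is
  \<open>sigma2 > 0\<close>.\<close>

lemma markov_kernel_exp_cov:
  assumes "sigma2 > 0" "kappa > 0"
  shows "markov_kernel (exp_cov sigma2 kappa)"
proof (rule markov_kernelI)
  fix s x t :: real assume "x \<in> {min s t..max s t}"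
  then have "\<bar>s - t\<bar> = \<bar>s - x\<bar> + \<bar>x - t\<bar>" by (auto simp: min_def max_def split: if_splits)
  then show "exp_cov sigma2 kappa s t * exp_cov sigma2 kappa x x
      = exp_cov sigma2 kappa s x * exp_cov sigma2 kappa x t"
    by (simp add: exp_cov_def mult_exp_exp diff_divide_distrib)
next
  fix s t :: real
  have "exp (- \<bar>s - t\<bar> / kappa) ^ 2 \<le> 1" using assms by (intro power_le_one) auto
  then show "(exp_cov sigma2 kappa s t)\<^sup>2
      \<le> exp_cov sigma2 kappa s s * exp_cov sigma2 kappa t t"
    using assms by (simp add: exp_cov_def power_mult_distrib power2_eq_square mult_le_cancel_left)
qed (use assms in \<open>auto simp: exp_cov_def abs_minus_commute\<close>)

section \<open>Conditioning on a single point\<close>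

text \<open>If \<open>v p p = 0\<close>, then \<open>x / 0 = 0\<close> leaves \<open>v\<close> unchanged. This is the right convention,
  since for a Markov kernel \<open>v p\<close> is then zero already.\<close>

definition pinned :: "('a \<Rightarrow> 'a \<Rightarrow> real) \<Rightarrow> 'a \<Rightarrow> 'a \<Rightarrow> 'a \<Rightarrow> real" where
  "pinned v p s t = v s t - v s p * v p t / v p p"

lemma pinned_eq_0:
  assumes "markov_kernel v" "p \<in> {min s t..max s t}"
  shows "pinned v p s t = 0"
  using markov_kernel_between[OF assms] markov_kernel_zero[OF assms]
    markov_kernel_zero[OF assms(1), of p s p]
  by (cases "v p p = 0") (auto simp: pinned_def field_simps)

lemma pinned_nonneg:
  assumes "markov_kernel v"
  shows "0 \<le> pinned v p s s"
  using markov_kernel_cs[OF assms, of s p] markov_kernel_sym[OF assms, of p s]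
    markov_kernel_nonneg[OF assms, of p] markov_kernel_nonneg[OF assms, of s]
  by (cases "v p p = 0") (auto simp: pinned_def field_simps power2_eq_square)

text \<open>The Markov property at \<open>s\<close> lets \<open>v s t\<close> be pulled out of both
  terms. What remains is one minus the squared correlation of \<open>p\<close> and \<open>s\<close>,
  which is the same for all \<open>t\<close> beyond \<open>s\<close>; it is \<open>1\<close> if
  \<open>v p p = 0\<close>.\<close>

lemma pinned_factor:
  assumes v: "markov_kernel v" and s: "s \<in> {min p t..max p t}" and nz: "v s s \<noteq> 0"
  shows "pinned v p s t = v s t * (1 - (v p s)\<^sup>2 / (v p p * v s s))"
proof -
  have "v p t = v p s * v s t / v s s"
    using markov_kernel_between[OF v s] nz by (simp add: field_simps)
  then show ?thesis
    using markov_kernel_sym[OF v, of s p] by (simp add: pinned_def power2_eq_square algebra_simps)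
qed

text \<open>On whichever side of \<open>x\<close> the point \<open>p\<close> falls, \<open>x\<close>
  separates it from \<open>s\<close> or from \<open>t\<close>, so the correction term vanishes
  together with \<open>v s t\<close>.\<close>

lemma pinned_eq_0_of_zero:
  assumes v: "markov_kernel v" and x: "x \<in> {min s t..max s t}" and "v x x = 0"
  shows "pinned v p s t = 0"
proof -
  have "v s t = 0" using markov_kernel_zero[OF assms] .
  moreover have "v s p = 0 \<or> v p t = 0"
  proof -
    have "x \<in> {min s p..max s p} \<or> x \<in> {min p t..max p t}"
      using x by (cases "s \<le> t"; cases "p \<le> x") (auto simp: min_le_iff_disj le_max_iff_disj)
    then show ?thesis
      using markov_kernel_zero[OF v _ \<open>v x x = 0\<close>] by blast
  qed
  ultimately show ?thesis by (auto simp: pinned_def)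
qed

lemma pinned_sym:
  assumes "markov_kernel v"
  shows "pinned v p s t = pinned v p t s"
  unfolding pinned_def using markov_kernel_sym[OF assms] by (metis mult.commute)

text \<open>With \<open>A\<close> the factor from \<open>pinned_factor\<close>, the claim is the
  Cauchy--Schwarz inequality for \<open>v\<close> at \<open>s\<close> and \<open>t\<close>,
  multiplied by \<open>A\<close>.\<close>

lemma pinned_cs_if_between:
  assumes v: "markov_kernel v" and s: "s \<in> {min p t..max p t}"
  shows "(pinned v p s t)\<^sup>2 \<le> pinned v p s s * pinned v p t t"
proof (cases "v s s = 0")
  case True
  then show ?thesis
    using pinned_eq_0_of_zero[OF v _ True, of s t p] pinned_nonneg[OF v] by auto
next
  case False
  define A where "A = 1 - (v p s)\<^sup>2 / (v p p * v s s)"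
  have st: "pinned v p s t = v s t * A" using pinned_factor[OF v s False] by (simp add: A_def)
  have ss: "pinned v p s s = v s s * A"
    using pinned_factor[OF v _ False, of p s] by (simp add: A_def)
  have pos: "0 < v s s" using False markov_kernel_nonneg[OF v, of s] by simp
  have "0 \<le> A" using pinned_nonneg[OF v, of p s] pos ss by (simp add: zero_le_mult_iff)
  have "v p t = v p s * v s t / v s s"
    using markov_kernel_between[OF v s] False by (simp add: field_simps)
  \<comment> \<open>Routing \<open>v p t\<close> through \<open>s\<close> expresses the variance
    lost at \<open>t\<close> by \<open>1 - A\<close>, the fraction lost at \<open>s\<close>.\<close>
  then have tt: "v s s * pinned v p t t = v s s * v t t - (v s t)\<^sup>2 * (1 - A)"
    using False
    by (simp add: pinned_def A_def markov_kernel_sym[OF v, of t p] power2_eq_square algebra_simps)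
  have "(v s t)\<^sup>2 * A \<le> v s s * pinned v p t t"
    unfolding tt using markov_kernel_cs[OF v, of s t] by (simp add: algebra_simps)
  then have "(v s t)\<^sup>2 * A * A \<le> v s s * pinned v p t t * A"
    using \<open>0 \<le> A\<close> by (rule mult_right_mono)
  then show ?thesis by (simp add: st ss power_mult_distrib power2_eq_square mult_ac)
qed

text \<open>The order is \<open>p\<close>, \<open>s\<close>, \<open>x\<close>, \<open>t\<close> up
  to reversal. If the variances at \<open>s\<close> and \<open>x\<close> are nonzero,
  \<open>pinned_factor\<close> gives both products the same two factors, one for \<open>s\<close>
  and one for \<open>x\<close>. The second claim rests on correlation with \<open>p\<close> not
  growing with distance.\<close>

lemma pinned_between_if_between:
  assumes v: "markov_kernel v" and x: "x \<in> {min s t..max s t}" and s: "s \<in> {min p t..max p t}"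
  shows "pinned v p s t * pinned v p x x = pinned v p s x * pinned v p x t"
    and "pinned v p x x = 0 \<Longrightarrow> pinned v p s t = 0"
proof -
  have sx: "s \<in> {min p x..max p x}" "x \<in> {min p t..max p t}"
    using x s by (auto simp: min_def max_def split: if_splits)
  have "pinned v p s t * pinned v p x x = pinned v p s x * pinned v p x t \<and>
      (pinned v p x x = 0 \<longrightarrow> pinned v p s t = 0)"
  proof (cases "v s s = 0 \<or> v x x = 0")
    case True
    then show ?thesis
      using pinned_eq_0_of_zero[OF v _, of s s t p] pinned_eq_0_of_zero[OF v x, of p]
        pinned_eq_0_of_zero[OF v _, of s s x p] pinned_eq_0_of_zero[OF v _, of x s x p] by auto
  next
    case False
    then have nz: "v s s \<noteq> 0" "v x x \<noteq> 0" by auto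
    define A where "A = 1 - (v p s)\<^sup>2 / (v p p * v s s)"
    define B where "B = 1 - (v p x)\<^sup>2 / (v p p * v x x)"
    have eqs: "pinned v p s t = v s t * A" "pinned v p s x = v s x * A"
        "pinned v p x t = v x t * B" "pinned v p x x = v x x * B"
      using pinned_factor[OF v s nz(1)] pinned_factor[OF v sx(1) nz(1)]
        pinned_factor[OF v sx(2) nz(2)] pinned_factor[OF v _ nz(2), of p x]
      by (auto simp: A_def B_def)
    \<comment> \<open>\<open>B = 0\<close> makes \<open>x\<close> perfectly correlated with
      \<open>p\<close>. Factoring \<open>v p x\<close> through \<open>s\<close> and bounding
      \<open>v s x\<close> then reverses Cauchy--Schwarz for \<open>p\<close> and \<open>s\<close>,
      so \<open>s\<close> is perfectly correlated with \<open>p\<close> too. Here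
      \<open>v p p\<close> is nonzero, since \<open>x / 0 = 0\<close> would give
      \<open>B = 1\<close>.\<close>
    have "A = 0" if "B = 0"
    proof -
      have pos: "0 < v s s" "0 < v x x" using nz markov_kernel_nonneg[OF v] by (metis order_le_less)+
      have p: "v p p \<noteq> 0" using that by (auto simp: B_def)
      then have "0 < v p p" using markov_kernel_nonneg[OF v] by (metis order_le_less)
      have "(v p x)\<^sup>2 = v p p * v x x" using that p nz by (simp add: B_def field_simps)
      moreover have "v p x * v s s = v p s * v s x" using markov_kernel_between[OF v sx(1)] .
      ultimately have "v p p * v x x * (v s s)\<^sup>2 = (v p s)\<^sup>2 * (v s x)\<^sup>2"
        by (metis power_mult_distrib)
      also have "\<dots> \<le> (v p s)\<^sup>2 * (v s s * v x x)"
        using markov_kernel_cs[OF v, of s x] by (intro mult_left_mono) auto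
      finally have "(v p p * v s s) * (v s s * v x x) \<le> (v p s)\<^sup>2 * (v s s * v x x)"
        by (simp add: power2_eq_square mult_ac)
      then have "v p p * v s s \<le> (v p s)\<^sup>2" using pos by (simp add: mult_le_cancel_right)
      then have "(v p s)\<^sup>2 = v p p * v s s" using markov_kernel_cs[OF v, of p s] by simp
      then show ?thesis using p nz by (simp add: A_def)
    qed
    moreover have "v s t * v x x = v s x * v x t" using markov_kernel_between[OF v x] .
    ultimately show ?thesis using nz by (auto simp: eqs algebra_simps)
  qed
  then show "pinned v p s t * pinned v p x x = pinned v p s x * pinned v p x t"
    and "pinned v p x x = 0 \<Longrightarrow> pinned v p s t = 0" by auto
qed

text \<open>One of \<open>p\<close>, \<open>s\<close>, \<open>t\<close> lies between the other two.
  If it is \<open>p\<close>, the residual at \<open>s\<close> and \<open>t\<close> is zero; the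
  other two cases are mirror images, exchanged by symmetry of the kernel.\<close>

lemma markov_kernel_pinned:
  fixes v :: "'a::linorder \<Rightarrow> 'a \<Rightarrow> real"
  assumes v: "markov_kernel v"
  shows "markov_kernel (pinned v p)"
proof (rule markov_kernelI)
  have cases: "p \<in> {min s t..max s t} \<or> s \<in> {min p t..max p t} \<or> t \<in> {min p s..max p s}" for s t
    by (auto simp: min_def max_def split: if_splits)
  show "pinned v p s t = pinned v p t s" for s t using pinned_sym[OF v] .
  show "0 \<le> pinned v p s s" for s using pinned_nonneg[OF v] .
  show "(pinned v p s t)\<^sup>2 \<le> pinned v p s s * pinned v p t t" for s t
    using cases[of s t] pinned_eq_0[OF v, of p s t] pinned_cs_if_between[OF v, of s p t]
      pinned_cs_if_between[OF v, of t p s] pinned_nonneg[OF v, of p] pinned_sym[OF v, of p s t]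
    by (auto simp: mult.commute)
  fix s x t :: 'a assume x: "x \<in> {min s t..max s t}"
  then have x': "x \<in> {min t s..max t s}" by (simp only: min.commute max.commute)
  have split: "p \<in> {min s x..max s x} \<or> p \<in> {min x t..max x t}" if "p \<in> {min s t..max s t}"
    using x that by (auto simp: min_def max_def split: if_splits)
  consider "p \<in> {min s t..max s t}" | "s \<in> {min p t..max p t}" | "t \<in> {min p s..max p s}"
    using cases by blast
  then show "pinned v p s t * pinned v p x x = pinned v p s x * pinned v p x t"
  proof cases
    \<comment> \<open>Both sides are zero: \<open>p\<close> also separates \<open>s\<close> from
      \<open>x\<close> or \<open>x\<close> from \<open>t\<close>.\<close>
    case 1
    then show ?thesis using split pinned_eq_0[OF v 1] pinned_eq_0[OF v, of p s x] pinned_eq_0[OF v, of p x t] by auto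
  next
    case 2
    then show ?thesis using pinned_between_if_between(1)[OF v x] by blast
  next
    case 3
    then show ?thesis using pinned_between_if_between(1)[OF v x' 3]
      by (simp add: pinned_sym[OF v, of p s t] pinned_sym[OF v, of p s x] pinned_sym[OF v, of p x t])
  qed
  show "pinned v p x x = 0 \<Longrightarrow> pinned v p s t = 0"
    using cases[of s t] pinned_eq_0[OF v, of p s t] pinned_between_if_between(2)[OF v x, of p]
      pinned_between_if_between(2)[OF v x', of p] pinned_sym[OF v, of p s t] by auto
qed

lemma pinned_self_eq_0:
  assumes "markov_kernel v"
  shows "pinned v p p p = 0"
  using pinned_eq_0[OF assms, of p p p] by simp

section \<open>Conditioning on a finite set, one point at a time\<close>

text \<open>The coefficients \<open>c t q\<close> are free of \<open>s\<close>, which later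
  identifies \<open>w\<close> with the matrix formula. Variances that are already zero stay zero, so
  knots of earlier resolutions are not lost.\<close>

lemma pinned_finite_set:
  assumes "markov_kernel v" "finite Q"
  shows "\<exists>w c. markov_kernel w \<and> (\<forall>q. q \<in> Q \<or> v q q = 0 \<longrightarrow> w q q = 0) \<and>
           (\<forall>s t. w s t = v s t - (\<Sum>q\<in>Q. v s q * c t q))"
  using assms(2)
proof (induction Q rule: finite_induct)
  case empty
  then show ?case using assms(1) by (intro exI[of _ v]) auto
next
  case (insert p Q)
  then obtain w c where w: "markov_kernel w" "\<And>q. q \<in> Q \<or> v q q = 0 \<Longrightarrow> w q q = 0"
    and c: "\<And>s t. w s t = v s t - (\<Sum>q\<in>Q. v s q * c t q)" by blast
  define d where "d t = w p t / w p p" for t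
  \<comment> \<open>These coefficients come from inserting the expansions of \<open>w s t\<close>
    and \<open>w s p\<close> into \<open>w s t - w s p * d t\<close> and collecting the terms in
    each \<open>v s q\<close>.\<close>
  define c' where "c' t q = (if q = p then d t else c t q - c p q * d t)" for t q
  have "pinned w p s t = v s t - (\<Sum>q\<in>insert p Q. v s q * c' t q)" for s t
  proof -
    have "(\<Sum>q\<in>Q. v s q * c' t q) = (\<Sum>q\<in>Q. v s q * c t q) - (\<Sum>q\<in>Q. v s q * c p q) * d t"
      unfolding sum_distrib_right sum_subtractf[symmetric]
      using insert.hyps by (intro sum.cong) (auto simp: c'_def algebra_simps)
    moreover have "pinned w p s t = w s t - w s p * d t" by (simp add: pinned_def d_def)
    ultimately show ?thesis using insert.hyps by (simp add: c[of s] c'_def[of t p] algebra_simps)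
  qed
  moreover have "pinned w p q q = 0" if "q \<in> insert p Q \<or> v q q = 0" for q
    using that pinned_self_eq_0[OF w(1)] pinned_eq_0_of_zero[OF w(1), of q q q p] w(2) by auto
  ultimately show ?case using markov_kernel_pinned[OF w(1)] by blast
qed

section \<open>Separation of regions by knots\<close>

text \<open>By connectedness of \<open>{s..t}\<close>, the closure of \<open>A i\<close> meets the closure of another member.\<close>

lemma exists_frontier_between:
  fixes A :: "'i \<Rightarrow> real set"
  assumes "finite I" and cover: "{s..t} \<subseteq> (\<Union>i\<in>I. A i)" and disj: "disjoint_family_on A I"
    and "s \<le> t" and i: "i \<in> I" "s \<in> A i" and t: "t \<notin> A i"
  shows "\<exists>j\<in>I. j \<noteq> i \<and> (\<exists>x\<in>{s..t}. x \<in> frontier (A i) \<inter> frontier (A j))"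
proof -
  let ?B = "\<Union>j\<in>I - {i}. closure (A j)"
  have "closed ?B" using \<open>finite I\<close> by (intro closed_UN) auto
  moreover have "{s..t} \<subseteq> closure (A i) \<union> ?B"
  proof
    fix x assume "x \<in> {s..t}"
    then obtain j where "j \<in> I" "x \<in> A j" using cover by blast
    moreover have "A j \<subseteq> closure (A j)" by (rule closure_subset)
    ultimately show "x \<in> closure (A i) \<union> ?B" by (cases "j = i") auto
  qed
  moreover have "closure (A i) \<inter> {s..t} \<noteq> {}"
    using subsetD[OF closure_subset i(2)] \<open>s \<le> t\<close> by auto
  moreover have "?B \<inter> {s..t} \<noteq> {}"
  proof -
    have "t \<in> {s..t}" using \<open>s \<le> t\<close> by simp
    then obtain j where j: "j \<in> I" "t \<in> A j" using cover by blast
    moreover have "t \<in> closure (A j)" using subsetD[OF closure_subset j(2)] .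
    ultimately show ?thesis using t \<open>t \<in> {s..t}\<close> by auto
  qed
  ultimately have "closure (A i) \<inter> ?B \<inter> {s..t} \<noteq> {}"
    using connected_Icc[of s t] unfolding connected_closed by (metis closed_closure)
  then obtain j x where j: "j \<in> I" "j \<noteq> i" and x: "x \<in> {s..t}" "x \<in> closure (A i)" "x \<in> closure (A j)"
    by blast
  \<comment> \<open>Disjointness upgrades closures to frontiers: an open set that misses a set also
    misses its closure.\<close>
  have "interior (A i) \<inter> A j = {}" "interior (A j) \<inter> A i = {}"
    using disj i j interior_subset unfolding disjoint_family_on_def by blast+
  then have "interior (A i) \<inter> closure (A j) = {}" "interior (A j) \<inter> closure (A i) = {}"
    using open_Int_closure_eq_empty[OF open_interior] by blast+
  then have "x \<in> frontier (A i) \<inter> frontier (A j)" using x by (auto simp: frontier_def)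
  then show ?thesis using j x by blast
qed

text \<open>At the first resolution that parts \<open>s\<close> and \<open>t\<close>, both still lie
  in one parent region, an interval containing \<open>{s..t}\<close>. Leaving the subregion of
  \<open>s\<close> crosses a frontier point shared by two siblings, which is a knot of the parent
  resolution. Resolution \<open>0\<close> never parts two points.\<close>

lemma modulating_eq_0_separated:
  assumes part: "recursive_interval_partition M J D" and knots: "knots_on_boundaries M J D Q"
    and "m \<le> M" "s \<le> t" "modulating J D m s t = 0"
  shows "\<exists>k<m. \<exists>x\<in>Q k. x \<in> {s..t}"
  using assms(3,5)
proof (induction m)
  case 0
  then show ?case using part
    by (auto simp: modulating_def region_index_def recursive_interval_partition_def)
next
  case (Suc m)
  show ?case
  proof (cases "modulating J D m s t = 0")
    case True
    then show ?thesis using Suc by (meson Suc_leD less_Suc_eq)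
  next
    case False
    then obtain js where js: "js \<in> region_index J m" "s \<in> D js" "t \<in> D js"
      by (auto simp: modulating_def split: if_splits)
    have D: "D js = (\<Union>j\<in>{1..J}. D (js @ [j]))"
        "disjoint_family_on (\<lambda>j. D (js @ [j])) {1..J}"
      and int: "is_interval (D js)"
      using part js(1) Suc.prems unfolding recursive_interval_partition_def
      by (meson Suc_le_lessD Suc_leD)+
    obtain i where i: "i \<in> {1..J}" "s \<in> D (js @ [i])" using js D(1) by blast
    have "js @ [i] \<in> region_index J (Suc m)" using js i by (auto simp: region_index_def)
    then have "t \<notin> D (js @ [i])"
      using Suc.prems i by (auto simp: modulating_def split: if_splits)
    moreover have "{s..t} \<subseteq> (\<Union>j\<in>{1..J}. D (js @ [j]))"
    proof -
      have "{s..t} \<subseteq> D js"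
        using js(2,3) mem_is_interval_1_I[OF int] by (meson atLeastAtMost_iff subsetI)
      then show ?thesis using D(1) by simp
    qed
    ultimately have "\<exists>j\<in>{1..J}. j \<noteq> i \<and>
        (\<exists>x\<in>{s..t}. x \<in> frontier (D (js @ [i])) \<inter> frontier (D (js @ [j])))"
      using i D(2) \<open>s \<le> t\<close>
      by (intro exists_frontier_between[where A = "\<lambda>j. D (js @ [j])"]) simp_all
    then obtain j x where j: "j \<in> {1..J}" "j \<noteq> i" and x: "x \<in> {s..t}"
        "x \<in> frontier (D (js @ [i])) \<inter> frontier (D (js @ [j]))" by blast
    have "m < M" using Suc.prems by simp
    then have "frontier (D (js @ [i])) \<inter> frontier (D (js @ [j])) \<subseteq> Q m"
      using knots js(1) i(1) j unfolding knots_on_boundaries_def by simp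
    then show ?thesis using x by blast
  qed
qed

lemma modulating_sym: "modulating J D m s t = modulating J D m t s"
  by (auto simp: modulating_def)

section \<open>Conditioning on a knot set through the inverse matrix\<close>

text \<open>For a Gaussian process with covariance \<open>v\<close> this is the conditional
  covariance given the values on \<open>Q\<close>. It is one step of the recursion before
  modulation.\<close>

definition conditioned :: "(real \<Rightarrow> real \<Rightarrow> real) \<Rightarrow> real set \<Rightarrow> real \<Rightarrow> real \<Rightarrow> real" where
  "conditioned v Q s t = v s t - scalar_prod (eval_row v s Q)
     (mat_inv (eval_mat v Q Q) *\<^sub>v eval_row v t Q)"

lemma mra_v_Suc:
  "mra_v J D Q C (Suc m) s t = conditioned (mra_v J D Q C m) (Q m) s t * modulating J D (Suc m) s t"
  by (simp add: conditioned_def)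

lemma mat_inv_inverse:
  assumes "A \<in> carrier_mat n n" "invertible_mat A"
  shows "mat_inv A \<in> carrier_mat n n" "mat_inv A * A = 1\<^sub>m n"
proof -
  obtain B where B: "A * B = 1\<^sub>m (dim_row A)" "B * A = 1\<^sub>m (dim_row B)"
    using assms(2) by (auto simp: invertible_mat_def inverts_mat_def)
  have "dim_row B = n" "dim_col B = n"
    using B assms(1) by (metis carrier_matD index_mult_mat(2,3) index_one_mat(2,3))+
  \<comment> \<open>Being a unit of the matrix ring excludes the outcome \<open>None\<close> of
    \<open>mat_inverse\<close>.\<close>
  then have "A \<in> Units (ring_mat TYPE(real) n n)"
    using B assms(1) by (auto simp: Units_def ring_mat_def intro!: bexI[of _ B])
  then obtain B' where "mat_inverse A = Some B'"
    using mat_inverse(1)[OF assms(1), of n] by (cases "mat_inverse A") auto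
  from this mat_inverse(2)[OF assms(1) this]
  show "mat_inv A \<in> carrier_mat n n" "mat_inv A * A = 1\<^sub>m n" by auto
qed

lemma scalar_prod_eval_row:
  assumes "finite Q"
  shows "scalar_prod (eval_row f s Q) (Matrix.vec (card Q) (\<lambda>i. g (sorted_list_of_set Q ! i)))
    = (\<Sum>q\<in>Q. f s q * g q)"
proof -
  have "bij_betw (\<lambda>i. sorted_list_of_set Q ! i) {..<card Q} Q"
    using assms by (intro bij_betw_nth) auto
  then show ?thesis
    by (simp add: eval_row_def scalar_prod_def atLeast0LessThan
        sum.reindex_bij_betw[where g = "\<lambda>q. f s q * g q", symmetric])
qed

text \<open>The matrix formula equals the kernel from \<open>pinned_finite_set\<close> and inherits
  its properties.\<close>

lemma markov_kernel_conditioned: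
  assumes v: "markov_kernel v" and fin: "finite Q" and inv: "invertible_mat (eval_mat v Q Q)"
  shows "markov_kernel (conditioned v Q)"
    and "q \<in> Q \<or> v q q = 0 \<Longrightarrow> conditioned v Q q q = 0"
proof -
  obtain w c where w: "markov_kernel w" "\<And>q. q \<in> Q \<or> v q q = 0 \<Longrightarrow> w q q = 0"
    and c: "\<And>s t. w s t = v s t - (\<Sum>q\<in>Q. v s q * c t q)"
    using pinned_finite_set[OF v fin] by blast
  define n where "n = card Q"
  define l where "l = (\<lambda>i. sorted_list_of_set Q ! i)"
  define A where "A = eval_mat v Q Q"
  have A: "A \<in> carrier_mat n n" by (simp add: A_def eval_mat_def n_def)
  \<comment> \<open>Both kernels subtract a combination of the \<open>v s q\<close>; vanishing on \<open>Q\<close> determines the coefficients.\<close>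
  have "w = conditioned v Q"
  proof (intro ext)
    fix s t
    define u where "u = Matrix.vec n (\<lambda>i. c t (l i))"
    have u: "u \<in> carrier_vec n" by (simp add: u_def)
    have ws: "w s t = v s t - scalar_prod (eval_row v s Q) u" for s
      unfolding c u_def n_def l_def by (simp add: scalar_prod_eval_row[OF fin, of v s "c t"])
    \<comment> \<open>Row \<open>i\<close> of this system says \<open>w (l i) t = 0\<close>: zero
      variance at a knot forces the kernel to vanish against every \<open>t\<close>.\<close>
    have "A *\<^sub>v u = eval_row v t Q"
    proof (rule eq_vecI)
      fix i assume "i < dim_vec (eval_row v t Q)"
      then have i: "i < n" by (simp add: eval_row_def n_def)
      then have "l i \<in> Q" unfolding l_def n_def using fin
        by (metis nth_mem set_sorted_list_of_set sorted_list_of_set.length_sorted_key_list_of_set)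
      then have "w (l i) t = 0"
        using markov_kernel_zero[OF w(1), of "l i" "l i" t] w(2) by simp
      then have "scalar_prod (eval_row v (l i) Q) u = v (l i) t" using ws[of "l i"] by simp
      moreover have "row A i = eval_row v (l i) Q"
        using i by (auto simp: A_def eval_mat_def eval_row_def n_def l_def)
      ultimately show "vec_index (A *\<^sub>v u) i = vec_index (eval_row v t Q) i"
        using i A markov_kernel_sym[OF v, of t "l i"] by (simp add: eval_row_def n_def l_def)
    qed (use A in \<open>simp add: eval_row_def n_def\<close>)
    then have "mat_inv A *\<^sub>v eval_row v t Q = (mat_inv A * A) *\<^sub>v u"
      using A u mat_inv_inverse(1)[OF A] inv
      by (metis A_def assoc_mult_mat_vec)
    also have "\<dots> = u" using mat_inv_inverse(2)[OF A] inv u by (simp add: A_def)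
    finally show "w s t = conditioned v Q s t" by (simp add: ws conditioned_def A_def)
  qed
  then show "markov_kernel (conditioned v Q)"
    and "q \<in> Q \<or> v q q = 0 \<Longrightarrow> conditioned v Q q q = 0" using w by auto
qed

section \<open>The recursion and its telescoping sum\<close>

text \<open>The three claims need a joint induction: zero variance at the knots used so far and the
  Markov property make the residual vanish across regions, so modulation changes nothing and the
  next kernel is again Markov.\<close>

lemma mra_v_markov_kernel:
  assumes C: "markov_kernel C"
    and part: "recursive_interval_partition M J D" and knots: "knots_on_boundaries M J D Q"
    and fin: "\<forall>m\<le>M. finite (Q m)" and inv: "\<forall>m\<le>M. invertible_mat (mra_Lambda J D Q C m)"
    and "m \<le> M"
  shows "markov_kernel (mra_v J D Q C m) \<and> (\<forall>k<m. \<forall>q\<in>Q k. mra_v J D Q C m q q = 0) \<and>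
    (\<forall>k<m. mra_v J D Q C (Suc k) = conditioned (mra_v J D Q C k) (Q k))"
  using \<open>m \<le> M\<close>
proof (induction m)
  case 0
  have "mra_v J D Q C 0 = C" using part
    by (auto simp: modulating_def region_index_def recursive_interval_partition_def)
  then show ?case using C by simp
next
  case (Suc m)
  let ?v = "mra_v J D Q C m" and ?w = "conditioned (mra_v J D Q C m) (Q m)"
  have m: "markov_kernel ?v" "\<forall>k<m. \<forall>q\<in>Q k. ?v q q = 0" "finite (Q m)"
      "invertible_mat (eval_mat ?v (Q m) (Q m))"
    using Suc fin inv by (auto simp: mra_Lambda_def)
  note w = markov_kernel_conditioned[OF m(1,3,4)]
  have zero: "?w q q = 0" if "q \<in> Q k" "k < Suc m" for q k
    using that m(2) w(2) by (metis less_Suc_eq)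
  have sep: "?w s t = 0" if "modulating J D (Suc m) s t = 0" for s t
  proof -
    \<comment> \<open>The separation lemma expects an ordered pair, hence \<open>min\<close> and
      \<open>max\<close>.\<close>
    have "modulating J D (Suc m) (min s t) (max s t) = 0"
      using that modulating_sym by (simp add: min_def max_def)
    from modulating_eq_0_separated[OF part knots Suc.prems _ this]
    obtain k x where "k < Suc m" "x \<in> Q k" "x \<in> {min s t..max s t}"
      by (metis min.cobounded1 max.cobounded1 order_trans)
    then show ?thesis using markov_kernel_zero[OF w(1)] zero by blast
  qed
  have "mra_v J D Q C (Suc m) s t = ?w s t" for s t
    unfolding mra_v_Suc using sep[of s t] by (auto simp: modulating_def)
  then have "mra_v J D Q C (Suc m) = ?w" by blast
  then show ?case using w(1) zero Suc by (auto simp: less_Suc_eq simp del: mra_v.simps)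
qed

lemma eval_col_eq_eval_row:
  assumes "markov_kernel v"
  shows "eval_col v Q t = eval_row v t Q"
  using markov_kernel_sym[OF assms] by (auto simp: eval_col_def eval_row_def)

text \<open>The final residual has zero variance at \<open>s\<close>, so it vanishes against every
  \<open>t\<close>, whether \<open>t\<close> is a knot or not.\<close>

lemma mra_cov_exact:
  assumes C: "markov_kernel C"
    and part: "recursive_interval_partition M J D" and knots: "knots_on_boundaries M J D Q"
    and fin: "\<forall>m\<le>M. finite (Q m)" and inv: "\<forall>m\<le>M. invertible_mat (mra_Lambda J D Q C m)"
    and s: "s \<in> (\<Union>m\<le>M. Q m)"
  shows "mra_cov M J D Q C s t = C s t"
proof -
  let ?v = "mra_v J D Q C" and ?w = "\<lambda>m. conditioned (mra_v J D Q C m) (Q m)"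
  note v = mra_v_markov_kernel[OF C part knots fin inv]
  have kernel: "markov_kernel (?v m)" if "m \<le> M" for m using v[OF that] by blast
have "mra_cov M J D Q C s t = (\<Sum>m\<le>M. ?v m s t - ?w m s t)"
    by (simp add: mra_cov_def conditioned_def mra_Lambda_def eval_col_eq_eval_row[OF kernel])
  \<comment> \<open>The term for \<open>M\<close> is split off because the residual equals the next
    kernel only below the last resolution.\<close>
  also have "\<dots> = (\<Sum>m<M. ?v m s t - ?v (Suc m) s t) + (?v M s t - ?w M s t)"
    using v[OF order_refl] by (simp add: lessThan_Suc_atMost[symmetric] del: mra_v.simps)
  also have "\<dots> = ?v 0 s t - ?w M s t" using sum_lessThan_telescope'[of "\<lambda>m. ?v m s t" M] by simp
  also have "?v 0 s t = C s t" using part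
    by (auto simp: modulating_def region_index_def recursive_interval_partition_def)
  also have "?w M s t = 0"
  proof -
    have M: "finite (Q M)" "invertible_mat (eval_mat (?v M) (Q M) (Q M))"
      using fin inv by (auto simp: mra_Lambda_def)
    note w = markov_kernel_conditioned[OF kernel[OF order_refl] M]
    have "s \<in> Q M \<or> ?v M s s = 0" using s v[OF order_refl] by (auto simp: le_less)
    then show ?thesis using markov_kernel_zero[OF w(1), of s s t] w(2) by simp
  qed
  finally show ?thesis by simp
qed

section \<open>Moments of normal vectors and the covariance of the process\<close>

text \<open>For nonzero \<open>a\<close> the moments come from the normal density. The zero
  combination is degenerate and has no density, so it is treated apart.\<close>

lemma centered_multivariate_normal_moments:
  assumes P: "prob_space P" and X: "centered_multivariate_normal P n S X" and a: "a \<in> carrier_vec n"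
  shows "(\<lambda>\<omega>. scalar_prod a (X \<omega>)) \<in> borel_measurable P"
    and "integrable P (\<lambda>\<omega>. scalar_prod a (X \<omega>))"
    and "(\<integral>\<omega>. scalar_prod a (X \<omega>) \<partial>P) = 0"
    and "integrable P (\<lambda>\<omega>. (scalar_prod a (X \<omega>))\<^sup>2)"
    and "(\<integral>\<omega>. (scalar_prod a (X \<omega>))\<^sup>2 \<partial>P) = scalar_prod a (S *\<^sub>v a)"
proof -
  interpret prob_space P by fact
  let ?Y = "\<lambda>\<omega>. scalar_prod a (X \<omega>)"
  have S: "S \<in> carrier_mat n n" and car: "\<And>\<omega>. \<omega> \<in> space P \<Longrightarrow> X \<omega> \<in> carrier_vec n"
    using X by (auto simp: centered_multivariate_normal_def)
  have "?Y \<in> borel_measurable P \<and> integrable P ?Y \<and> (\<integral>\<omega>. ?Y \<omega> \<partial>P) = 0 \<and>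
      integrable P (\<lambda>\<omega>. (?Y \<omega>)\<^sup>2) \<and> (\<integral>\<omega>. (?Y \<omega>)\<^sup>2 \<partial>P) = scalar_prod a (S *\<^sub>v a)"
  proof (cases "a = 0\<^sub>v n")
    case True
    then have 0: "?Y \<omega> = 0" if "\<omega> \<in> space P" for \<omega> using car[OF that] by simp
    have "?Y \<in> borel_measurable P \<longleftrightarrow> (\<lambda>_. 0 :: real) \<in> borel_measurable P"
      using 0 by (intro measurable_cong) auto
    moreover have "integrable P ?Y \<longleftrightarrow> integrable P (\<lambda>_. 0 :: real)"
      using 0 by (intro Bochner_Integration.integrable_cong) auto
    moreover have "integrable P (\<lambda>\<omega>. (?Y \<omega>)\<^sup>2) \<longleftrightarrow> integrable P (\<lambda>_. 0 :: real)"
      using 0 by (intro Bochner_Integration.integrable_cong) auto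
    moreover have "(\<integral>\<omega>. ?Y \<omega> \<partial>P) = (\<integral>\<omega>. 0 \<partial>P)"
      using 0 by (intro Bochner_Integration.integral_cong) auto
    moreover have "(\<integral>\<omega>. (?Y \<omega>)\<^sup>2 \<partial>P) = (\<integral>\<omega>. 0 \<partial>P)"
      using 0 by (intro Bochner_Integration.integral_cong) auto
    moreover have "scalar_prod a (S *\<^sub>v a) = 0" using True S by simp
    ultimately show ?thesis by simp
  next
    case False
    define r where "r = sqrt (scalar_prod a (S *\<^sub>v a))"
    have pos: "0 < scalar_prod a (S *\<^sub>v a)" and D: "distributed P lborel ?Y (normal_density 0 r)"
      using X a False by (auto simp: centered_multivariate_normal_def r_def)
    have r: "0 < r" "r\<^sup>2 = scalar_prod a (S *\<^sub>v a)" using pos by (auto simp: r_def)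
    have meas: "?Y \<in> borel_measurable P" using distributed_measurable[OF D] by simp
    have int: "integrable P (\<lambda>\<omega>. (?Y \<omega>) ^ k)" for k
      using integrable_normal_moment[OF r(1), of 0 k] distributed_integrable[OF D, of "\<lambda>x. x ^ k"]
      by simp
    have "expectation ?Y = 0" using normal_distributed_expectation[OF r(1) D] .
    moreover have "expectation (\<lambda>\<omega>. (?Y \<omega>)\<^sup>2) = r\<^sup>2"
      using normal_distributed_variance[OF r(1) D] calculation by simp
    ultimately show ?thesis using meas int[of 1] int[of 2] r by simp
  qed
  then show "?Y \<in> borel_measurable P" and "integrable P ?Y" and "(\<integral>\<omega>. ?Y \<omega> \<partial>P) = 0"
    and "integrable P (\<lambda>\<omega>. (?Y \<omega>)\<^sup>2)" and "(\<integral>\<omega>. (?Y \<omega>)\<^sup>2 \<partial>P) = scalar_prod a (S *\<^sub>v a)"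
    by auto
qed

text \<open>Polarization: the mixed moment comes from the variances of the combinations
  \<open>a + b\<close>, \<open>a\<close> and \<open>b\<close>, using the symmetry of
  \<open>S\<close>.\<close>

lemma centered_multivariate_normal_second_moment:
  assumes P: "prob_space P" and X: "centered_multivariate_normal P n S X"
    and a: "a \<in> carrier_vec n" and b: "b \<in> carrier_vec n"
  shows "has_bochner_integral P (\<lambda>\<omega>. scalar_prod a (X \<omega>) * scalar_prod b (X \<omega>))
           (scalar_prod a (S *\<^sub>v b))"
proof -
  let ?Y = "\<lambda>a \<omega>. scalar_prod a (X \<omega>)" and ?q = "\<lambda>a. scalar_prod a (S *\<^sub>v a)"
  have S: "S \<in> carrier_mat n n" "transpose_mat S = S"
    and car: "\<And>\<omega>. \<omega> \<in> space P \<Longrightarrow> X \<omega> \<in> carrier_vec n"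
    using X by (auto simp: centered_multivariate_normal_def)
  note mom = centered_multivariate_normal_moments[OF P X]
  have sq: "has_bochner_integral P (\<lambda>\<omega>. (?Y a \<omega>)\<^sup>2) (?q a)" if "a \<in> carrier_vec n" for a
    using mom(4,5)[OF that] by (simp add: has_bochner_integral_iff)
  have "has_bochner_integral P (\<lambda>\<omega>. ((?Y (a + b) \<omega>)\<^sup>2 - (?Y a \<omega>)\<^sup>2 - (?Y b \<omega>)\<^sup>2) / 2)
      ((?q (a + b) - ?q a - ?q b) / 2)"
    using a b by (intro has_bochner_integral_divide has_bochner_integral_diff sq) auto
  moreover have "(?q (a + b) - ?q a - ?q b) / 2 = scalar_prod a (S *\<^sub>v b)"
  proof -
    have "scalar_prod b (S *\<^sub>v a) = scalar_prod a (S *\<^sub>v b)"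
      using S a b by (metis comm_scalar_prod mult_mat_vec_carrier transpose_vec_mult_scalar)
    then show ?thesis using S a b
      by (simp add: mult_add_distrib_mat_vec[of S n n] add_scalar_prod_distrib[of _ n]
          scalar_prod_add_distrib[of _ n])
  qed
  moreover have "((?Y (a + b) \<omega>)\<^sup>2 - (?Y a \<omega>)\<^sup>2 - (?Y b \<omega>)\<^sup>2) / 2 = ?Y a \<omega> * ?Y b \<omega>"
    if "\<omega> \<in> space P" for \<omega>
    using car[OF that] a b by (simp add: add_scalar_prod_distrib[of _ n] power2_eq_square algebra_simps)
  ultimately show ?thesis by (simp cong: has_bochner_integral_cong)
qed

text \<open>In the double sum, independence and zero means remove the off-diagonal terms.\<close>

lemma covariance_sum_centered_normal:
  fixes M :: nat
  assumes P: "prob_space P"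
    and X: "\<And>m. m \<le> M \<Longrightarrow> centered_multivariate_normal P (n m) (S m) (X m)"
    and ind: "prob_space.indep_vars P (\<lambda>m. Pi\<^sub>M {..<n m} (\<lambda>_. borel))
            (\<lambda>m \<omega>. \<lambda>i\<in>{..<n m}. vec_index (X m \<omega>) i) {..M}"
    and a: "\<And>m. m \<le> M \<Longrightarrow> a m \<in> carrier_vec (n m)" and b: "\<And>m. m \<le> M \<Longrightarrow> b m \<in> carrier_vec (n m)"
  shows "covariance P (\<lambda>\<omega>. \<Sum>m\<le>M. scalar_prod (a m) (X m \<omega>)) (\<lambda>\<omega>. \<Sum>m\<le>M. scalar_prod (b m) (X m \<omega>))
    = (\<Sum>m\<le>M. scalar_prod (a m) (S m *\<^sub>v b m))"
proof -
  interpret prob_space P by fact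
  let ?Y = "\<lambda>a m \<omega>. scalar_prod (a m) (X m \<omega>)"
  note mom = centered_multivariate_normal_moments[OF P X]
  have mean: "expectation (\<lambda>\<omega>. \<Sum>m\<le>M. ?Y a m \<omega>) = 0"
    if "\<And>m. m \<le> M \<Longrightarrow> a m \<in> carrier_vec (n m)" for a
    using mom(2,3) that by (subst Bochner_Integration.integral_sum) auto
  have cross: "has_bochner_integral P (\<lambda>\<omega>. ?Y a m \<omega> * ?Y b k \<omega>)
      (if m = k then scalar_prod (a m) (S m *\<^sub>v b m) else 0)" if mk: "m \<le> M" "k \<le> M" for m k
  proof (cases "m = k")
    case True
    then show ?thesis
      using centered_multivariate_normal_second_moment[OF P X a b] mk by simp
  next
    case False
    \<comment> \<open>A single family that uses \<open>a m\<close> at \<open>m\<close> and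
      \<open>b k\<close> at \<open>k\<close>, so that the independence of one transformed family
      covers the mixed product.\<close>
    define c where "c = a(k := b k)"
    let ?f = "\<lambda>m x. \<Sum>i<n m. vec_index (c m) i * x i"
    let ?Z = "\<lambda>l \<omega>. ?f l (\<lambda>i\<in>{..<n l}. vec_index (X l \<omega>) i)"
    have eq: "?Z l \<omega> = ?Y c l \<omega>" if "l \<le> M" "\<omega> \<in> space P" for l \<omega>
    proof -
      have "dim_vec (X l \<omega>) = n l" using X that by (auto simp: centered_multivariate_normal_def)
      then show ?thesis by (simp add: scalar_prod_def atLeast0LessThan)
    qed
    have c: "c l \<in> carrier_vec (n l)" if "l \<le> M" for l
      using a[OF that] b[OF that] by (auto simp: c_def)
    have "indep_vars (\<lambda>_. borel) ?Z {..M}"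
      by (rule indep_vars_compose2[OF ind]) measurable
    then have ind': "indep_vars (\<lambda>_. borel) ?Z {m, k}"
      by (rule indep_vars_subset) (use mk in auto)
    have int: "integrable P (?Z l)" and zero: "expectation (?Z l) = 0" if "l \<le> M" for l
      using mom(2,3)[OF that c[OF that]] eq[OF that]
      by (simp_all cong: Bochner_Integration.integrable_cong Bochner_Integration.integral_cong)
    have "integrable P (\<lambda>\<omega>. \<Prod>l\<in>{m, k}. ?Z l \<omega>)"
      by (rule indep_vars_integrable[OF _ ind']) (use int mk in auto)
    moreover have "expectation (\<lambda>\<omega>. \<Prod>l\<in>{m, k}. ?Z l \<omega>) = (\<Prod>l\<in>{m, k}. expectation (?Z l))"
      by (rule indep_vars_lebesgue_integral[OF _ ind']) (use int mk in auto)
    ultimately have "has_bochner_integral P (\<lambda>\<omega>. ?Z m \<omega> * ?Z k \<omega>) 0"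
      using False zero[OF mk(1)] by (simp add: has_bochner_integral_iff)
    moreover have "?Z m \<omega> * ?Z k \<omega> = ?Y a m \<omega> * ?Y b k \<omega>" if "\<omega> \<in> space P" for \<omega>
      using eq[OF mk(1) that] eq[OF mk(2) that] False by (simp add: c_def)
    ultimately show ?thesis
      using False by (simp cong: has_bochner_integral_cong)
  qed
  have "covariance P (\<lambda>\<omega>. \<Sum>m\<le>M. ?Y a m \<omega>) (\<lambda>\<omega>. \<Sum>m\<le>M. ?Y b m \<omega>)
      = expectation (\<lambda>\<omega>. \<Sum>m\<le>M. \<Sum>k\<le>M. ?Y a m \<omega> * ?Y b k \<omega>)"
    by (simp add: covariance_def mean a b sum_product)
  also have "\<dots> = (\<Sum>m\<le>M. \<Sum>k\<le>M. if m = k then scalar_prod (a m) (S m *\<^sub>v b m) else 0)"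
    by (intro has_bochner_integral_integral_eq has_bochner_integral_sum cross) auto
  also have "\<dots> = (\<Sum>m\<le>M. scalar_prod (a m) (S m *\<^sub>v b m))" by simp
  finally show ?thesis .
qed

theorem proposition6:
  fixes sigma2 kappa :: real and M J :: nat
    and D :: "nat list \<Rightarrow> real set" and Q :: "nat \<Rightarrow> real set"
  assumes "sigma2 > 0" and "kappa > 0" and "J \<ge> 2"
    and "recursive_interval_partition M J D"
    and "\<forall>m\<le>M. finite (Q m)"
    and "\<forall>m\<le>M. invertible_mat (mra_Lambda J D Q (exp_cov sigma2 kappa) m)"
    and "\<forall>m<M. card (Q m) = (J - 1) * J ^ m"
    and "knots_on_boundaries M J D Q"
  shows "\<forall>s1\<in>(\<Union>m\<le>M. Q m). \<forall>s2\<in>(\<Union>m\<le>M. Q m).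
           mra_cov M J D Q (exp_cov sigma2 kappa) s1 s2 = exp_cov sigma2 kappa s1 s2 \<and>
           (\<forall>(P :: 'w measure) y. mra_block_process P M J D Q (exp_cov sigma2 kappa) y \<longrightarrow>
              covariance P (y s1) (y s2) = exp_cov sigma2 kappa s1 s2)"
proof (intro ballI conjI allI impI)
  let ?C = "exp_cov sigma2 kappa"
  note kernel = markov_kernel_exp_cov[OF assms(1,2)]
  fix s1 s2 assume s1: "s1 \<in> (\<Union>m\<le>M. Q m)"
  show cov: "mra_cov M J D Q ?C s1 s2 = ?C s1 s2"
    using mra_cov_exact[OF kernel assms(4,8,5,6) s1] .
  fix P :: "'w measure" and y assume "mra_block_process P M J D Q ?C y"
  then obtain \<eta> where P: "prob_space P"
    and normal: "\<forall>m\<le>M. centered_multivariate_normal P (card (Q m)) (mat_inv (mra_Lambda J D Q ?C m)) (\<eta> m)"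
    and indep: "prob_space.indep_vars P (\<lambda>m. Pi\<^sub>M {..<card (Q m)} (\<lambda>_. borel))
            (\<lambda>m \<omega>. \<lambda>i\<in>{..<card (Q m)}. vec_index (\<eta> m \<omega>) i) {..M}"
    and y: "y = (\<lambda>s \<omega>. \<Sum>m\<le>M. scalar_prod (mra_b J D Q ?C m s) (\<eta> m \<omega>))"
    unfolding mra_block_process_def by blast
  have carrier: "mra_b J D Q ?C m s \<in> carrier_vec (card (Q m))" for m s
    by (simp add: mra_b_def eval_row_def)
  have "covariance P (y s1) (y s2) = (\<Sum>m\<le>M. scalar_prod (mra_b J D Q ?C m s1)
      (mat_inv (mra_Lambda J D Q ?C m) *\<^sub>v mra_b J D Q ?C m s2))"
    unfolding y
    by (rule covariance_sum_centered_normal[OF P _ indep carrier carrier]) (use normal in blast)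
  \<comment> \<open>The two expressions differ only by \<open>eval_row\<close> against
    \<open>eval_col\<close>, which agree by symmetry of the kernels.\<close>
  also have "\<dots> = mra_cov M J D Q ?C s1 s2"
    using mra_v_markov_kernel[OF kernel assms(4,8,5,6)]
    by (simp add: mra_cov_def mra_b_def eval_col_eq_eval_row)
  finally show "covariance P (y s1) (y s2) = ?C s1 s2" using cov by simp
qed

end
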